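(* Let $D\ge 1$ and $N>2D$ be integers, let $q$ be a prime power, let $\Gamma=J_q(N,D)$, let $x$ be a vertex of $\Gamma$, and let $A^*=A^*(x)$ be the dual adjacency matrix. For every subspace $\alpha\subseteq x$, $$A^*\alpha^{\mathcal{N}}=\theta^*_{D-\dim\alpha}\,\alpha^{\mathcal{N}}.$$
   Context: Let $\mathbb{F}_q$ be a finite field with $q$ elements and $\mathcal{V}$ an $N$-dimensional vector space over $\mathbb{F}_q$. The Grassmann graph $\Gamma=J_q(N,D)$ has vertex set $X$ consisting of the $D$-dimensional subspaces of $\mathcal{V}$; $y,z\in X$ are adjacent iff $\dim(y\cap z)=D-1$. For $N>2D$ it has diameter $D$ and path-length distance $\partial(y,z)=D-\dim(y\cap z)$. $[\ell]=\frac{q^\ell-1}{q-1}$ for integers $\ell$. The adjacency matrix $A$ has distinct eigenvalues $\theta_0>\theta_1>\cdots>\theta_D$; let $E_1$ be the orthogonal projection of $V=\mathbb{C}^X$ onto the $\theta_1$-eigenspace. The dual adjacency matrix $A^*=A^*(x)$ is the diagonal matrix with $(y,y)$-entry $|X|(E_1)_{x,y}$. One has $A^*=\sum_{i=0}^D\theta_i^*E_i^*$, where $E_i^*$ is the diagonal matrix with $(y,y)$-entry $1$ if $\partial(x,y)=i$ and $0$ otherwise, and the dual eigenvalues are $$\theta_i^*=-\frac{q[N-1]([D]+[N-D])}{(q-1)[D][N-D]}+\frac{q[N][N-1]}{(q-1)[D][N-D]}q^{-i}\qquad(0\le i\le D).$$ For $y\in X$ let $\widehat y\in V$ have $1$ in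 coordinate $y$ and $0$ elsewhere. For a subspace $\alpha\subseteq x$, $\alpha^{\mathcal{N}}=\sum_{y\in X,\ y\cap x=\alpha}\widehat y$. *)

theory Defs
  imports Complex_Main "HOL-Library.Cardinality"
begin

section \<open>Complex vectors and matrices indexed by a finite set\<close>

text \<open>
  For a finite set \<open>X\<close>, the space of complex vectors with coordinates indexed by \<open>X\<close> is
  represented by the functions that vanish outside \<open>X\<close>; a matrix is a function of two indices,
  of which only the entries with both indices in \<open>X\<close> matter.
\<close>

definition coord_space :: "'a set \<Rightarrow> ('a \<Rightarrow> complex) set" where
  "coord_space X = {f. \<forall>y. y \<notin> X \<longrightarrow> f y = 0}"

definition unit_vector :: "'a \<Rightarrow> 'a \<Rightarrow> complex" where
  "unit_vector y = (\<lambda>z. if z = y then 1 else 0)"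

definition mat_vec :: "'a set \<Rightarrow> ('a \<Rightarrow> 'a \<Rightarrow> complex) \<Rightarrow> ('a \<Rightarrow> complex) \<Rightarrow> 'a \<Rightarrow> complex" where
  "mat_vec X M f = (\<lambda>y. if y \<in> X then \<Sum>z\<in>X. M y z * f z else 0)"

definition hermitian :: "'a set \<Rightarrow> ('a \<Rightarrow> complex) \<Rightarrow> ('a \<Rightarrow> complex) \<Rightarrow> complex" where
  "hermitian X f g = (\<Sum>y\<in>X. f y * cnj (g y))"

definition eigenspace :: "'a set \<Rightarrow> ('a \<Rightarrow> 'a \<Rightarrow> complex) \<Rightarrow> complex \<Rightarrow> ('a \<Rightarrow> complex) set" where
  "eigenspace X M \<theta> = {f \<in> coord_space X. mat_vec X M f = (\<lambda>y. \<theta> * f y)}"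

text \<open>
  Only real eigenvalues are collected, so that they can be ordered. For a real symmetric matrix,
  such as an adjacency matrix, these are all the eigenvalues.
\<close>

definition real_eigenvalues :: "'a set \<Rightarrow> ('a \<Rightarrow> 'a \<Rightarrow> complex) \<Rightarrow> real set" where
  "real_eigenvalues X M = {\<theta>. \<exists>f \<in> eigenspace X M (complex_of_real \<theta>). f \<noteq> (\<lambda>_. 0)}"

text \<open>The \<open>i\<close>-th distinct eigenvalue in decreasing order, counting from \<open>0\<close>.\<close>

definition nth_eigenvalue :: "'a set \<Rightarrow> ('a \<Rightarrow> 'a \<Rightarrow> complex) \<Rightarrow> nat \<Rightarrow> real" where
  "nth_eigenvalue X M i = rev (sorted_list_of_set (real_eigenvalues X M)) ! i"

definition orth_proj ::
    "'a set \<Rightarrow> ('a \<Rightarrow> complex) set \<Rightarrow> ('a \<Rightarrow> complex) \<Rightarrow> 'a \<Rightarrow> complex" where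
  "orth_proj X U f = (THE g. g \<in> U \<and> (\<forall>u\<in>U. hermitian X (\<lambda>y. f y - g y) u = 0))"

text \<open>The matrix of the orthogonal projection; its column \<open>z\<close> is the image of the unit vector at \<open>z\<close>.\<close>

definition orth_proj_matrix :: "'a set \<Rightarrow> ('a \<Rightarrow> complex) set \<Rightarrow> 'a \<Rightarrow> 'a \<Rightarrow> complex" where
  "orth_proj_matrix X U = (\<lambda>y z. orth_proj X U (unit_vector z) y)"


section \<open>The Grassmann graph and its dual adjacency matrix\<close>

text \<open>
  Throughout, \<open>scale\<close> is the scalar multiplication of a vector space structure on the type \<open>'v\<close>
  over the field \<open>'k\<close>; the ambient vector space is \<open>UNIV\<close>.
\<close>

definition grassmann_vertices ::
    "('k::field \<Rightarrow> 'v::ab_group_add \<Rightarrow> 'v) \<Rightarrow> nat \<Rightarrow> 'v set set" where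
  "grassmann_vertices scale D = {y. module.subspace scale y \<and> vector_space.dim scale y = D}"

text \<open>The condition \<open>dim (y \<inter> z) = D - 1\<close> is only meant for \<open>D \<ge> 1\<close>; subtraction is truncated.\<close>

definition grassmann_adjacency ::
    "('k::field \<Rightarrow> 'v::ab_group_add \<Rightarrow> 'v) \<Rightarrow> nat \<Rightarrow> 'v set \<Rightarrow> 'v set \<Rightarrow> complex" where
  "grassmann_adjacency scale D = (\<lambda>y z.
     if y \<in> grassmann_vertices scale D \<and> z \<in> grassmann_vertices scale D
        \<and> vector_space.dim scale (y \<inter> z) = D - 1
     then 1 else 0)"

definition grassmann_E1 ::
    "('k::field \<Rightarrow> 'v::ab_group_add \<Rightarrow> 'v) \<Rightarrow> nat \<Rightarrow> 'v set \<Rightarrow> 'v set \<Rightarrow> complex" where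
  "grassmann_E1 scale D =
     (let X = grassmann_vertices scale D; A = grassmann_adjacency scale D
      in orth_proj_matrix X (eigenspace X A (complex_of_real (nth_eigenvalue X A 1))))"

definition dual_adjacency ::
    "('k::field \<Rightarrow> 'v::ab_group_add \<Rightarrow> 'v) \<Rightarrow> nat \<Rightarrow> 'v set \<Rightarrow> 'v set \<Rightarrow> 'v set \<Rightarrow> complex" where
  "dual_adjacency scale D x = (\<lambda>y z.
     if y = z then of_nat (card (grassmann_vertices scale D)) * grassmann_E1 scale D x y else 0)"

definition q_bracket :: "nat \<Rightarrow> int \<Rightarrow> real" where
  "q_bracket q l = (real q powi l - 1) / (real q - 1)"

definition dual_eigenvalue :: "nat \<Rightarrow> nat \<Rightarrow> nat \<Rightarrow> nat \<Rightarrow> real" where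
  "dual_eigenvalue q N D i =
     - (real q * q_bracket q (int N - 1) * (q_bracket q (int D) + q_bracket q (int N - int D)))
         / ((real q - 1) * q_bracket q (int D) * q_bracket q (int N - int D))
     + (real q * q_bracket q (int N) * q_bracket q (int N - 1))
         / ((real q - 1) * q_bracket q (int D) * q_bracket q (int N - int D))
       * real q powi (- int i)"

definition N_vector ::
    "('k::field \<Rightarrow> 'v::ab_group_add \<Rightarrow> 'v) \<Rightarrow> nat \<Rightarrow> 'v set \<Rightarrow> 'v set \<Rightarrow> 'v set \<Rightarrow> complex" where
  "N_vector scale D x \<alpha> =
     (\<lambda>z. \<Sum>y\<in>{y \<in> grassmann_vertices scale D. y \<inter> x = \<alpha>}. unit_vector y z)"

end

theory Submission
  imports Defs
begin

text \<open>
  Summation over hyperplanes (\<open>lower_sum\<close>) and over covers (\<open>upper_sum\<close>) moves between functions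
  on \<open>j\<close>-dimensional and on \<open>(j + 1)\<close>-dimensional subspaces, and both composites are the adjacency
  operator plus a scalar. Hence an eigenvector on level \<open>j + 1\<close> is either killed by the downward
  map, with eigenvalue \<open>-[j + 1]\<close>, or is carried to an eigenvector on level \<open>j\<close> with eigenvalue shifted
  by a constant. Descending to level \<open>1\<close> shows that the second largest eigenvalue on level \<open>D\<close> belongs
  to the functions \<open>y \<mapsto> \<Sum>p \<subseteq> y. g p\<close> over points \<open>p\<close>, with \<open>g\<close> of sum zero. On these
  functions the Gram matrix of the point-subspace incidence acts as a scalar, which gives the
  projection: \<open>(E\<^sub>1)\<^bsub>x,y\<^esub>\<close> is an affine function of the number \<open>[dim (x \<inter> y)]\<close> of common points.
\<close>

section \<open>Counting subspaces\<close>

definition q_num :: "nat \<Rightarrow> nat \<Rightarrow> nat" where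
  "q_num q n = (\<Sum>i<n. q ^ i)"

definition q_fact :: "nat \<Rightarrow> nat \<Rightarrow> nat" where
  "q_fact q n = (\<Prod>i<n. q_num q (Suc i))"

lemma q_num_0 [simp]: "q_num q 0 = 0"
  and q_num_1 [simp]: "q_num q (Suc 0) = 1"
  by (simp_all add: q_num_def)

lemma q_num_Suc: "q_num q (Suc n) = q_num q n + q ^ n"
  by (simp add: q_num_def)

lemma q_num_add: "q_num q (m + n) = q_num q m + q ^ m * q_num q n"
  by (induction n) (simp_all add: q_num_Suc power_add algebra_simps)

lemma q_num_strict_mono: "0 < q \<Longrightarrow> m < n \<Longrightarrow> q_num q m < q_num q n"
  by (induction n) (auto simp: q_num_Suc less_Suc_eq intro: trans_less_add1)

lemma q_num_pos: "0 < n \<Longrightarrow> 0 < q_num q n"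
  by (cases n) (auto simp: q_num_def lessThan_Suc_eq_insert_0)

lemma power_eq_q_num:
  assumes "q > 0"
  shows "q ^ n = (q - 1) * q_num q n + 1"
proof -
  obtain r where "q = Suc r" using assms gr0_implies_Suc by blast
  then show ?thesis by (induction n) (auto simp: q_num_Suc algebra_simps)
qed

lemma of_nat_q_num: "q > 1 \<Longrightarrow> real (q_num q n) = (real q ^ n - 1) / (real q - 1)"
  by (simp add: q_num_def sum_gp_strict divide_simps) (simp add: algebra_simps)

lemma q_fact_0 [simp]: "q_fact q 0 = 1"
  by (simp add: q_fact_def)

lemma q_fact_Suc: "q_fact q (Suc n) = q_num q (Suc n) * q_fact q n"
  by (simp add: q_fact_def)

lemma q_fact_pos: "0 < q_fact q n"
  by (simp add: q_fact_def prod_pos q_num_pos)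

locale finite_field_vector_space = finite_dimensional_vector_space scale Basis
  for scale :: "'k::{field,finite} \<Rightarrow> 'v::ab_group_add \<Rightarrow> 'v" (infixr \<open>*s\<close> 75) and Basis +
  fixes q :: nat
  assumes card_field: "CARD('k) = q"
begin

abbreviation "Gr \<equiv> grassmann_vertices scale"

lemma q_gt_1: "1 < q"
proof -
  have "card {0, 1 :: 'k} \<le> q"
    unfolding card_field[symmetric] by (rule card_mono) auto
  then show ?thesis by simp
qed

lemma mem_Gr: "y \<in> Gr j \<longleftrightarrow> subspace y \<and> dim y = j"
  by (simp add: grassmann_vertices_def)

lemma card_span_insert:
  assumes "finite (span S)" and "a \<notin> span S"
  shows "card (span (insert a S)) = q * card (span S)"
proof -
  have "inj_on (\<lambda>(k, u). k *s a + u) (UNIV \<times> span S)"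
  proof (rule inj_onI, clarify)
    fix k u l v assume "u \<in> span S" "v \<in> span S" and eq: "k *s a + u = l *s a + v"
    then have "(k - l) *s a = v - u"
      by (simp add: algebra_simps)
    then have *: "(k - l) *s a \<in> span S"
      using \<open>u \<in> span S\<close> \<open>v \<in> span S\<close> by (simp add: span_diff)
    have "k = l"
    proof (rule ccontr)
      assume "k \<noteq> l"
      then have "a = (1 / (k - l)) *s ((k - l) *s a)" by simp
      then show False using * assms(2) by (metis span_scale)
    qed
    then show "k = l \<and> u = v" using eq by simp
  qed
  moreover have "(\<lambda>(k, u). k *s a + u) ` (UNIV \<times> span S) = span (insert a S)"
  proof (intro equalityI subsetI)
    fix v assume "v \<in> span (insert a S)"
    then obtain k where "v - k *s a \<in> span S" by (auto simp: span_insert)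
    then show "v \<in> (\<lambda>(k, u). k *s a + u) ` (UNIV \<times> span S)"
      by (intro image_eqI[of _ _ "(k, v - k *s a)"]) auto
  next
    fix v assume "v \<in> (\<lambda>(k, u). k *s a + u) ` (UNIV \<times> span S)"
    then obtain k u where "u \<in> span S" "v = k *s a + u" by auto
    then have "v - k *s a \<in> span S" by simp
    then show "v \<in> span (insert a S)" unfolding span_insert by blast
  qed
  ultimately have "card (span (insert a S)) = card ((UNIV :: 'k set) \<times> span S)"
    by (metis card_image)
  then show ?thesis by (simp add: card_cartesian_product card_field)
qed

lemma finite_card_span:
  assumes "finite B" and "independent B"
  shows "finite (span B) \<and> card (span B) = q ^ card B"
  using assms
proof (induction B rule: finite_induct)
  case (insert a B)
  then have "independent B" and a: "a \<notin> span B"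
    by (simp_all add: independent_insert)
  with insert.IH have fin: "finite (span B)" and "card (span B) = q ^ card B"
    by simp_all
  with a have c: "card (span (insert a B)) = q * q ^ card B"
    by (simp add: card_span_insert)
  then have "finite (span (insert a B))"
    using q_gt_1 by (intro card_ge_0_finite) simp
  with c show ?case using insert.hyps by simp
qed simp

lemma finite_UNIV_space: "finite (UNIV :: 'v set)"
  using conjunct1[OF finite_card_span[OF finite_Basis independent_Basis]]
  unfolding span_Basis .

lemma finite_space [simp]: "finite (A :: 'v set)"
  using finite_subset[OF subset_UNIV finite_UNIV_space] .

lemma finite_sets [simp]: "finite (\<A> :: 'v set set)"
  using finite_subset[of \<A> "Pow UNIV"] finite_UNIV_space by blast

lemma card_subspace: "subspace y \<Longrightarrow> card y = q ^ dim y"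
proof -
  assume "subspace y"
  obtain B where B: "B \<subseteq> y" "independent B" "y \<subseteq> span B" "card B = dim y"
    by (rule basis_exists)
  then have "span B = y" using \<open>subspace y\<close> by (intro span_subspace)
  then show ?thesis using finite_card_span[OF finiteI_independent] B by auto
qed

lemma dim_insert_subspace: "subspace w \<Longrightarrow> a \<notin> w \<Longrightarrow> dim (insert a w) = Suc (dim w)"
  by (simp add: dim_insert span_eq_iff[THEN iffD2])

lemma card_covers:
  assumes w: "w \<in> Gr d" and y: "y \<in> Gr m" and "w \<subseteq> y"
  shows "card {z \<in> Gr (Suc d). w \<subseteq> z \<and> z \<subseteq> y} = q_num q (m - d)"
proof -
  let ?Z = "{z \<in> Gr (Suc d). w \<subseteq> z \<and> z \<subseteq> y}"
  have sw: "subspace w" "dim w = d" and sy: "subspace y" "dim y = m"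
    using w y by (auto simp: mem_Gr)
  have le: "d \<le> m" using dim_subset[OF \<open>w \<subseteq> y\<close>] sw sy by simp
  have eq: "z = span (insert a w)" if "z \<in> Gr (Suc d)" "w \<subseteq> z" "a \<in> z - w" for z a
  proof -
    have "dim (span (insert a w)) = Suc d"
      using that sw by (simp add: dim_insert_subspace)
    moreover have "span (insert a w) \<subseteq> z"
      using that by (intro span_minimal) (auto simp: mem_Gr)
    ultimately show ?thesis
      using that subspace_dim_equal[of "span (insert a w)" z] by (auto simp: mem_Gr)
  qed
  have "y - w = (\<Union>z\<in>?Z. z - w)"
  proof safe
    fix a assume "a \<in> y" "a \<notin> w"
    then have "span (insert a w) \<subseteq> y"
      using sy \<open>w \<subseteq> y\<close> by (intro span_minimal) auto
    moreover have "w \<subseteq> span (insert a w)" by (auto intro: span_base)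
    ultimately have "span (insert a w) \<in> ?Z"
      using sw \<open>a \<notin> w\<close> by (simp add: mem_Gr dim_insert_subspace)
    moreover have "a \<in> span (insert a w)" by (simp add: span_base)
    ultimately show "a \<in> (\<Union>z\<in>?Z. z - w)" using \<open>a \<notin> w\<close> by blast
  qed auto
  then have "card (y - w) = (\<Sum>z\<in>?Z. card (z - w))"
  proof (simp only:, intro card_UN_disjoint ballI impI)
    show "(z - w) \<inter> (z' - w) = {}" if "z \<in> ?Z" "z' \<in> ?Z" "z \<noteq> z'" for z z'
      using that eq[of z] eq[of z'] by (smt (verit) disjoint_iff mem_Collect_eq DiffD1)
  qed auto
  also have "\<dots> = (\<Sum>z\<in>?Z. q ^ Suc d - q ^ d)"
    by (intro sum.cong refl) (auto simp: card_Diff_subset card_subspace mem_Gr sw)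
  finally have "card ?Z * ((q - 1) * q ^ d) = q ^ m - q ^ d"
    using sw sy \<open>w \<subseteq> y\<close> by (simp add: card_Diff_subset card_subspace diff_mult_distrib)
  also have "\<dots> = (q ^ (m - d) - 1) * q ^ d"
    using le by (simp add: diff_mult_distrib flip: power_add)
  finally have "card ?Z * (q - 1) = q ^ (m - d) - 1"
    using q_gt_1 by simp
  also have "\<dots> = q_num q (m - d) * (q - 1)"
    using power_eq_q_num[of q "m - d"] q_gt_1 by simp
  finally show ?thesis using q_gt_1 by simp
qed

lemma card_between:
  assumes "w \<in> Gr d" and "y \<in> Gr m" and "w \<subseteq> y" and "d \<le> k" and "k \<le> m"
  shows "card {z \<in> Gr k. w \<subseteq> z \<and> z \<subseteq> y} * q_fact q (k - d) * q_fact q (m - k) = q_fact q (m - d)"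
  using assms
proof (induction "k - d" arbitrary: w d)
  case 0
  then have "z = w" if "z \<in> Gr k" "w \<subseteq> z" for z
    using that subspace_dim_equal[of w z] by (auto simp: mem_Gr)
  moreover have "w \<in> Gr k" using 0 by simp
  ultimately have "{z \<in> Gr k. w \<subseteq> z \<and> z \<subseteq> y} = {w}"
    using \<open>w \<subseteq> y\<close> by blast
  with 0 show ?case by simp
next
  case (Suc c)
  let ?V = "{v \<in> Gr (Suc d). w \<subseteq> v \<and> v \<subseteq> y}" and ?Z = "\<lambda>w. {z \<in> Gr k. w \<subseteq> z \<and> z \<subseteq> y}"
  have kd: "k - d = Suc c" "k - Suc d = c" "m - d = Suc (m - Suc d)"
    using Suc by auto
  have "card (?Z w) * q_num q (k - d) = (\<Sum>z\<in>?Z w. q_num q (k - d))"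
    by simp
  also have "\<dots> = (\<Sum>z\<in>?Z w. card {v \<in> Gr (Suc d). w \<subseteq> v \<and> v \<subseteq> z})"
    by (intro sum.cong refl card_covers[symmetric] Suc.prems(1)) auto
  also have "\<dots> = (\<Sum>z\<in>?Z w. card {v \<in> ?V. v \<subseteq> z})"
    by (intro sum.cong refl arg_cong[where f = card]) auto
  also have "\<dots> = (\<Sum>v\<in>?V. card {z \<in> ?Z w. v \<subseteq> z})"
    using sum.swap_restrict[of "?Z w" ?V "\<lambda>_ _. 1::nat" "\<lambda>z v. v \<subseteq> z"] by simp
  also have "\<dots> = (\<Sum>v\<in>?V. card (?Z v))"
    by (intro sum.cong refl arg_cong[where f = card]) auto
  finally have "card (?Z w) * q_num q (k - d) * q_fact q c * q_fact q (m - k)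
      = (\<Sum>v\<in>?V. card (?Z v) * q_fact q c * q_fact q (m - k))"
    by (simp add: sum_distrib_right)
  also have "\<dots> = (\<Sum>v\<in>?V. q_fact q (m - Suc d))"
    using Suc.hyps(1)[of "Suc d"] Suc.prems kd by (intro sum.cong refl) auto
  also have "\<dots> = q_fact q (m - d)"
    using card_covers[OF Suc.prems(1-3)] kd by (simp add: q_fact_Suc)
  finally show ?case using kd by (simp add: q_fact_Suc ac_simps)
qed

lemma card_hyperplanes:
  assumes "w \<in> Gr d" and "y \<in> Gr (Suc m)" and "w \<subseteq> y" and "d \<le> m"
  shows "card {z \<in> Gr m. w \<subseteq> z \<and> z \<subseteq> y} = q_num q (Suc m - d)"
proof -
  have "card {z \<in> Gr m. w \<subseteq> z \<and> z \<subseteq> y} * q_fact q (m - d) = q_num q (Suc m - d) * q_fact q (m - d)"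
    using card_between[OF assms le_SucI[OF order_refl]] assms(4)
    by (simp add: q_fact_Suc Suc_diff_le)
  then show ?thesis using q_fact_pos[of q "m - d"] by simp
qed

lemma zero_mem_Gr: "{0} \<in> Gr 0"
  by (simp add: mem_Gr)

lemma zero_mem: "z \<in> Gr k \<Longrightarrow> 0 \<in> z"
  by (simp add: mem_Gr subspace_0)

lemma Gr_0: "Gr 0 = {{0}}"
proof -
  have "z = {0}" if "z \<in> Gr 0" for z
    using that zero_mem[OF that] by (auto simp: mem_Gr)
  then show ?thesis using zero_mem_Gr by blast
qed

lemma UNIV_mem_Gr: "UNIV \<in> Gr dimension"
  by (simp add: mem_Gr dimension_def)

lemma Gr_above_zero: "{z \<in> Gr k. {0} \<subseteq> z \<and> z \<subseteq> y} = {z \<in> Gr k. z \<subseteq> y}"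
  by (auto dest: zero_mem)

lemma card_subspaces_containing:
  assumes "w \<in> Gr d" and "d \<le> k" and "k \<le> dimension"
  shows "card {z \<in> Gr k. w \<subseteq> z} * q_fact q (k - d) * q_fact q (dimension - k)
    = q_fact q (dimension - d)"
  using card_between[OF assms(1) UNIV_mem_Gr _ assms(2,3)] by simp

lemma card_points_in:
  assumes "y \<in> Gr m"
  shows "card {p \<in> Gr (Suc 0). p \<subseteq> y} = q_num q m"
  using card_covers[OF zero_mem_Gr assms] zero_mem[OF assms]
  unfolding Gr_above_zero by simp

lemma card_covers_containing:
  assumes "w \<in> Gr d"
  shows "card {z \<in> Gr (Suc d). w \<subseteq> z} = q_num q (dimension - d)"
  using card_covers[OF assms UNIV_mem_Gr] by simp

lemma card_hyperplanes_in:
  assumes "y \<in> Gr (Suc m)"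
  shows "card {z \<in> Gr m. z \<subseteq> y} = q_num q (Suc m)"
  using card_hyperplanes[OF zero_mem_Gr assms _ le0] zero_mem[OF assms]
  unfolding Gr_above_zero by simp

subsection \<open>Incidence operators\<close>

definition lower_sum :: "nat \<Rightarrow> ('v set \<Rightarrow> complex) \<Rightarrow> 'v set \<Rightarrow> complex" where
  "lower_sum j f y = (\<Sum>z | z \<in> Gr j \<and> z \<subseteq> y. f z)"

definition upper_sum :: "nat \<Rightarrow> ('v set \<Rightarrow> complex) \<Rightarrow> 'v set \<Rightarrow> complex" where
  "upper_sum j f y = (\<Sum>z | z \<in> Gr j \<and> y \<subseteq> z. f z)"

definition nbr_sum :: "nat \<Rightarrow> ('v set \<Rightarrow> complex) \<Rightarrow> 'v set \<Rightarrow> complex" where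
  "nbr_sum j f y = (\<Sum>z | z \<in> Gr j \<and> Suc (dim (y \<inter> z)) = j. f z)"

lemma lower_sum_cong: "(\<And>z. z \<in> Gr j \<Longrightarrow> f z = g z) \<Longrightarrow> lower_sum j f y = lower_sum j g y"
  by (simp add: lower_sum_def)

lemma upper_sum_cong: "(\<And>z. z \<in> Gr j \<Longrightarrow> f z = g z) \<Longrightarrow> upper_sum j f y = upper_sum j g y"
  by (simp add: upper_sum_def)

lemma lower_sum_scale: "lower_sum j (\<lambda>z. c * f z) y = c * lower_sum j f y"
  by (simp add: lower_sum_def sum_distrib_left)

lemma upper_sum_scale: "upper_sum j (\<lambda>z. c * f z) y = c * upper_sum j f y"
  by (simp add: upper_sum_def sum_distrib_left)

lemma lower_upper_sum:
  "lower_sum j (upper_sum k f) y = (\<Sum>z\<in>Gr k. of_nat (card {w \<in> Gr j. w \<subseteq> y \<and> w \<subseteq> z}) * f z)"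
proof -
  let ?L = "{w \<in> Gr j. w \<subseteq> y}"
  have "lower_sum j (upper_sum k f) y = (\<Sum>z\<in>Gr k. \<Sum>w | w \<in> ?L \<and> w \<subseteq> z. f z)"
    using sum.swap_restrict[of ?L "Gr k" "\<lambda>_ z. f z" "(\<subseteq>)"]
    by (simp add: lower_sum_def upper_sum_def)
  then show ?thesis by (simp add: conj_assoc)
qed

lemma upper_lower_sum:
  "upper_sum k (lower_sum j f) y = (\<Sum>z\<in>Gr j. of_nat (card {u \<in> Gr k. y \<subseteq> u \<and> z \<subseteq> u}) * f z)"
proof -
  let ?U = "{u \<in> Gr k. y \<subseteq> u}"
  have "upper_sum k (lower_sum j f) y = (\<Sum>z\<in>Gr j. \<Sum>u | u \<in> ?U \<and> z \<subseteq> u. f z)"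
    using sum.swap_restrict[of ?U "Gr j" "\<lambda>_ z. f z" "\<lambda>u z. z \<subseteq> u"]
    by (simp add: lower_sum_def upper_sum_def)
  then show ?thesis by (simp add: conj_assoc)
qed

lemma dim_Int_less:
  assumes "y \<in> Gr j" and "z \<in> Gr j" and "y \<noteq> z"
  shows "dim (y \<inter> z) < j"
proof (rule ccontr)
  assume "\<not> dim (y \<inter> z) < j"
  then have "dim (y \<inter> z) \<ge> j" by simp
  then have "y \<inter> z = y" and "y \<inter> z = z"
    using assms by (intro subspace_dim_equal; simp add: mem_Gr subspace_inter)+
  then have "y = z" by (rule trans[OF sym])
  with assms(3) show False by simp
qed

lemma card_common_hyperplanes:
  assumes "y \<in> Gr (Suc j)" and "z \<in> Gr (Suc j)" and "y \<noteq> z"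
  shows "card {w \<in> Gr j. w \<subseteq> y \<and> w \<subseteq> z} = (if dim (y \<inter> z) = j then 1 else 0)"
proof -
  have less: "dim (y \<inter> z) \<le> j" using dim_Int_less[OF assms] by simp
  have sub: "subspace (y \<inter> z)" using assms by (simp add: mem_Gr subspace_inter)
  have *: "w = y \<inter> z" if "w \<in> Gr j" "w \<subseteq> y" "w \<subseteq> z" for w
    using that less sub by (intro subspace_dim_equal) (auto simp: mem_Gr)
  show ?thesis
  proof (cases "dim (y \<inter> z) = j")
    case True
    then have "y \<inter> z \<in> Gr j" using sub by (simp add: mem_Gr)
    then have "{w \<in> Gr j. w \<subseteq> y \<and> w \<subseteq> z} = {y \<inter> z}"
      using * by blast
    then show ?thesis using True by simp
  next
    case False
    then have "y \<inter> z \<notin> Gr j" by (simp add: mem_Gr)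
    then have "{w \<in> Gr j. w \<subseteq> y \<and> w \<subseteq> z} = {}"
      using * by blast
    then show ?thesis using False by simp
  qed
qed

lemma card_common_covers:
  assumes "y \<in> Gr j" and "z \<in> Gr j" and "y \<noteq> z"
  shows "card {u \<in> Gr (Suc j). y \<subseteq> u \<and> z \<subseteq> u} = (if Suc (dim (y \<inter> z)) = j then 1 else 0)"
proof -
  have sy: "subspace y" "dim y = j" and sz: "subspace z" "dim z = j"
    using assms by (auto simp: mem_Gr)
  have sub: "subspace (y \<inter> z)" using sy sz by (simp add: subspace_inter)
  have less: "dim (y \<inter> z) < j" using dim_Int_less[OF assms] .
  have "\<not> z \<subseteq> y" using subspace_dim_equal[of z y] sy sz assms(3) by auto
  then obtain a where a: "a \<in> z" "a \<notin> y" by blast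
  let ?u = "span (insert a y)"
  have u: "?u \<in> Gr (Suc j)" "y \<subseteq> ?u"
    using sy a by (auto simp: mem_Gr dim_insert_subspace intro: span_base)
  have uniq: "u = ?u" if "u \<in> Gr (Suc j)" "y \<subseteq> u" "z \<subseteq> u" for u
  proof -
    have "?u \<subseteq> u" using that a by (intro span_minimal) (auto simp: mem_Gr)
    then show ?thesis
      using that u subspace_dim_equal[of ?u u] by (auto simp: mem_Gr)
  qed
  have iff: "z \<subseteq> ?u \<longleftrightarrow> Suc (dim (y \<inter> z)) = j"
  proof
    assume zu: "z \<subseteq> ?u"
    have "z \<subseteq> span (insert a (y \<inter> z))"
    proof
      fix b assume "b \<in> z"
      then have "b \<in> span (insert a y)" using zu by blast
      then obtain k where "b - k *s a \<in> span y" unfolding span_breakdown_eq by blast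
      then have "b - k *s a \<in> y \<inter> z"
        using sy sz a \<open>b \<in> z\<close> by (simp add: span_eq_iff[THEN iffD2] subspace_diff subspace_scale)
      then show "b \<in> span (insert a (y \<inter> z))"
        unfolding span_breakdown_eq by (blast intro: span_base)
    qed
    then have "dim z \<le> dim (insert a (y \<inter> z))" by (metis dim_mono)
    also have "\<dots> = Suc (dim (y \<inter> z))" using sub a by (simp add: dim_insert_subspace)
    finally show "Suc (dim (y \<inter> z)) = j" using less sz by simp
  next
    assume j: "Suc (dim (y \<inter> z)) = j"
    have "span (insert a (y \<inter> z)) = z"
    proof (rule subspace_dim_equal)
      show "span (insert a (y \<inter> z)) \<subseteq> z" using sz a by (intro span_minimal) auto
      show "dim z \<le> dim (span (insert a (y \<inter> z)))"
        using sub sz a j by (simp add: dim_insert_subspace)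
    qed (use sz in auto)
    then show "z \<subseteq> ?u" using span_mono[of "insert a (y \<inter> z)" "insert a y"] by blast
  qed
  show ?thesis
  proof (cases "Suc (dim (y \<inter> z)) = j")
    case True
    then have "{u \<in> Gr (Suc j). y \<subseteq> u \<and> z \<subseteq> u} = {?u}"
      using uniq u iff by blast
    then show ?thesis using True by simp
  next
    case False
    then have "{u \<in> Gr (Suc j). y \<subseteq> u \<and> z \<subseteq> u} = {}"
      using uniq iff by blast
    then show ?thesis using False by simp
  qed
qed

lemma sum_weighted_nbr:
  assumes y: "y \<in> Gr j" and diag: "c y = a"
    and off: "\<And>z. z \<in> Gr j \<Longrightarrow> y \<noteq> z \<Longrightarrow> c z = (if Suc (dim (y \<inter> z)) = j then 1 else 0)"
  shows "(\<Sum>z\<in>Gr j. of_nat (c z) * f z) = of_nat a * f y + nbr_sum j f y"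
proof -
  have y0: "Suc (dim (y \<inter> y)) \<noteq> j" using y by (simp add: mem_Gr)
  have "(\<Sum>z\<in>Gr j. of_nat (c z) * f z) = of_nat a * f y + (\<Sum>z\<in>Gr j - {y}. of_nat (c z) * f z)"
    using y diag by (simp add: sum.remove)
  also have "(\<Sum>z\<in>Gr j - {y}. of_nat (c z) * f z)
      = (\<Sum>z\<in>Gr j - {y}. if Suc (dim (y \<inter> z)) = j then f z else 0)"
  proof (intro sum.cong refl)
    fix z assume "z \<in> Gr j - {y}"
    then have "c z = (if Suc (dim (y \<inter> z)) = j then 1 else 0)"
      by (intro off) auto
    then show "of_nat (c z) * f z = (if Suc (dim (y \<inter> z)) = j then f z else 0)" by simp
  qed
  also have "\<dots> = (\<Sum>z | z \<in> Gr j - {y} \<and> Suc (dim (y \<inter> z)) = j. f z)"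
    by (rule sum.inter_filter[symmetric]) simp
  also have "{z. z \<in> Gr j - {y} \<and> Suc (dim (y \<inter> z)) = j} = {z \<in> Gr j. Suc (dim (y \<inter> z)) = j}"
    using y0 by auto
  finally show ?thesis by (simp add: nbr_sum_def)
qed

lemma lower_upper_sum_nbr:
  assumes "y \<in> Gr (Suc j)"
  shows "lower_sum j (upper_sum (Suc j) f) y = of_nat (q_num q (Suc j)) * f y + nbr_sum (Suc j) f y"
  unfolding lower_upper_sum
  using assms by (intro sum_weighted_nbr) (auto simp: card_hyperplanes_in card_common_hyperplanes)

lemma upper_lower_sum_nbr:
  assumes "y \<in> Gr j"
  shows "upper_sum (Suc j) (lower_sum j f) y
    = of_nat (q_num q (dimension - j)) * f y + nbr_sum j f y"
  unfolding upper_lower_sum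
  using assms by (intro sum_weighted_nbr) (auto simp: card_covers_containing card_common_covers)

definition eigen :: "nat \<Rightarrow> real \<Rightarrow> ('v set \<Rightarrow> complex) \<Rightarrow> bool" where
  "eigen j \<theta> f \<longleftrightarrow> (\<forall>y\<in>Gr j. nbr_sum j f y = of_real \<theta> * f y)"

definition shift :: "nat \<Rightarrow> real" where
  "shift j = real (q_num q (dimension - j)) - real (q_num q (Suc j))"

lemma eigen_upper_sum:
  assumes "eigen (Suc j) \<theta> f"
  shows "eigen j (\<theta> - shift j) (upper_sum (Suc j) f)"
  unfolding eigen_def
proof
  fix w assume w: "w \<in> Gr j"
  let ?d = "upper_sum (Suc j) f"
  have "of_nat (q_num q (dimension - j)) * ?d w + nbr_sum j ?d w = upper_sum (Suc j) (lower_sum j ?d) w"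
    using upper_lower_sum_nbr[OF w] by simp
  also have "\<dots> = upper_sum (Suc j) (\<lambda>y. (of_nat (q_num q (Suc j)) + of_real \<theta>) * f y) w"
    using assms by (intro upper_sum_cong) (simp add: lower_upper_sum_nbr eigen_def algebra_simps)
  also have "\<dots> = (of_nat (q_num q (Suc j)) + of_real \<theta>) * ?d w"
    by (rule upper_sum_scale)
  finally show "nbr_sum j ?d w = of_real (\<theta> - shift j) * ?d w"
    by (simp add: shift_def algebra_simps)
qed

lemma eigen_lower_sum:
  assumes "eigen j \<theta> f"
  shows "eigen (Suc j) (\<theta> + shift j) (lower_sum j f)"
  unfolding eigen_def
proof
  fix y assume y: "y \<in> Gr (Suc j)"
  let ?u = "lower_sum j f"
  have "of_nat (q_num q (Suc j)) * ?u y + nbr_sum (Suc j) ?u y = lower_sum j (upper_sum (Suc j) ?u) y"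
    using lower_upper_sum_nbr[OF y] by simp
  also have "\<dots> = lower_sum j (\<lambda>z. (of_nat (q_num q (dimension - j)) + of_real \<theta>) * f z) y"
    using assms by (intro lower_sum_cong) (simp add: upper_lower_sum_nbr eigen_def algebra_simps)
  also have "\<dots> = (of_nat (q_num q (dimension - j)) + of_real \<theta>) * ?u y"
    by (rule lower_sum_scale)
  finally show "nbr_sum (Suc j) ?u y = of_real (\<theta> + shift j) * ?u y"
    by (simp add: shift_def algebra_simps)
qed

lemma lower_sum_lower_sum:
  assumes "y \<in> Gr (Suc j)" and "i \<le> j"
  shows "lower_sum j (lower_sum i g) y = of_nat (q_num q (Suc j - i)) * lower_sum i g y"
proof -
  let ?L = "{z \<in> Gr j. z \<subseteq> y}"
  have "lower_sum j (lower_sum i g) y = (\<Sum>p\<in>Gr i. \<Sum>z | z \<in> ?L \<and> p \<subseteq> z. g p)"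
    using sum.swap_restrict[of ?L "Gr i" "\<lambda>_ p. g p" "\<lambda>z p. p \<subseteq> z"]
    by (simp add: lower_sum_def)
  also have "\<dots> = (\<Sum>p\<in>Gr i. if p \<subseteq> y then of_nat (q_num q (Suc j - i)) * g p else 0)"
  proof (intro sum.cong refl)
    fix p assume p: "p \<in> Gr i"
    have "{z. z \<in> ?L \<and> p \<subseteq> z} = (if p \<subseteq> y then {z \<in> Gr j. p \<subseteq> z \<and> z \<subseteq> y} else {})"
      by auto
    then show "(\<Sum>z | z \<in> ?L \<and> p \<subseteq> z. g p) = (if p \<subseteq> y then of_nat (q_num q (Suc j - i)) * g p else 0)"
      using card_hyperplanes[OF p assms(1) _ assms(2)] by simp
  qed
  also have "\<dots> = (\<Sum>p | p \<in> Gr i \<and> p \<subseteq> y. of_nat (q_num q (Suc j - i)) * g p)"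
    by (rule sum.inter_filter[symmetric]) simp
  finally show ?thesis by (simp add: lower_sum_def sum_distrib_left)
qed

lemma eigen_cong:
  assumes "\<And>y. y \<in> Gr j \<Longrightarrow> f y = g y"
  shows "eigen j \<theta> f \<longleftrightarrow> eigen j \<theta> g"
  using assms by (simp add: eigen_def nbr_sum_def)

lemma eigen_scale: "c \<noteq> 0 \<Longrightarrow> eigen j \<theta> (\<lambda>y. c * f y) \<longleftrightarrow> eigen j \<theta> f"
  by (simp add: eigen_def nbr_sum_def mult.left_commute flip: sum_distrib_left)

lemma eigen_Suc_lower_sum:
  assumes "eigen j \<theta> (lower_sum i g)" and "i \<le> j"
  shows "eigen (Suc j) (\<theta> + shift j) (lower_sum i g)"
proof -
  have "eigen (Suc j) (\<theta> + shift j) (\<lambda>y. of_nat (q_num q (Suc j - i)) * lower_sum i g y)"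
    using eigen_lower_sum[OF assms(1)] assms(2)
    by (subst eigen_cong[OF lower_sum_lower_sum[symmetric]]) auto
  moreover have "of_nat (q_num q (Suc j - i)) \<noteq> (0::complex)"
    using q_num_pos[of "Suc j - i" q] assms(2) by simp
  ultimately show ?thesis by (simp add: eigen_scale)
qed

definition eigval0 :: "nat \<Rightarrow> real" where
  "eigval0 j = (\<Sum>i<j. shift i)"

definition eigval1 :: "nat \<Rightarrow> real" where
  "eigval1 j = eigval0 j - real (q_num q dimension)"

lemma eigen_const: "eigen j (eigval0 j) (lower_sum 0 g)"
proof (induction j)
  case 0
  show ?case by (simp add: eigen_def nbr_sum_def eigval0_def)
next
  case (Suc j)
  then show ?case using eigen_Suc_lower_sum by (simp add: eigval0_def)
qed

lemma upper_sum_zero_space: "upper_sum j f {0} = (\<Sum>z\<in>Gr j. f z)"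
proof -
  have "{z. z \<in> Gr j \<and> {0} \<subseteq> z} = Gr j" by (auto dest: zero_mem)
  then show ?thesis by (simp add: upper_sum_def)
qed

lemma lower_sum_same:
  assumes "y \<in> Gr j"
  shows "lower_sum j f y = f y"
proof -
  have "z = y" if "z \<in> Gr j" "z \<subseteq> y" for z
    using that assms by (intro subspace_dim_equal) (auto simp: mem_Gr)
  then have "{z. z \<in> Gr j \<and> z \<subseteq> y} = {y}" using assms by auto
  then show ?thesis by (simp add: lower_sum_def)
qed

lemma eigen_points:
  assumes "1 \<le> j" and "(\<Sum>p\<in>Gr (Suc 0). g p) = 0"
  shows "eigen j (eigval1 j) (lower_sum (Suc 0) g)"
  using assms(1)
proof (induction j rule: dec_induct)
  case base
  have "nbr_sum (Suc 0) g y = - g y" if "y \<in> Gr (Suc 0)" for y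
  proof -
    have "lower_sum 0 (upper_sum (Suc 0) g) y = 0"
      using assms(2) Gr_0 by (simp add: lower_sum_def upper_sum_zero_space)
    then show ?thesis using lower_upper_sum_nbr[OF that, of g] by (simp add: eq_neg_iff_add_eq_0 add.commute)
  qed
  moreover have "eigval1 1 = -1"
    by (simp add: eigval1_def eigval0_def shift_def)
  ultimately have "eigen 1 (eigval1 1) g" by (simp add: eigen_def)
  then show ?case using eigen_cong[of 1 "lower_sum (Suc 0) g" g] lower_sum_same by simp
next
  case (step j)
  then have "eigen (Suc j) (eigval1 j + shift j) (lower_sum (Suc 0) g)"
    by (intro eigen_Suc_lower_sum) simp_all
  then show ?case by (simp add: eigval1_def eigval0_def algebra_simps)
qed

subsection \<open>Eigenvalues of the Grassmann graph\<close>

lemma eigval_Suc: "eigval0 (Suc j) = eigval0 j + shift j" "eigval1 (Suc j) = eigval1 j + shift j"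
  by (simp_all add: eigval0_def eigval1_def)

lemma eigval1_lower_bound:
  assumes "1 \<le> j" and "2 * j < dimension"
  shows "- real (q_num q j) \<le> eigval1 j"
  using assms
proof (induction j rule: dec_induct)
  case base
  show ?case by (simp add: eigval1_def eigval0_def shift_def)
next
  case (step j)
  have "q_num q j < q_num q (dimension - j)"
    using step.prems q_gt_1 by (intro q_num_strict_mono) auto
  with step show ?case by (simp add: eigval_Suc shift_def)
qed

lemma eigval1_Suc_lower_bound:
  assumes "1 \<le> j" and "2 * Suc j < dimension"
  shows "- real (q_num q (Suc j)) < eigval1 (Suc j)"
proof -
  have "q_num q j < q_num q (dimension - j)"
    using assms q_gt_1 by (intro q_num_strict_mono) auto
  with eigval1_lower_bound[of j] assms show ?thesis by (simp add: eigval_Suc shift_def)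
qed

lemma eigen_lower_upper_sum:
  assumes "eigen (Suc j) \<theta> f" and "y \<in> Gr (Suc j)"
  shows "lower_sum j (upper_sum (Suc j) f) y = of_real (real (q_num q (Suc j)) + \<theta>) * f y"
  using assms by (simp add: lower_upper_sum_nbr eigen_def algebra_simps)

lemma eigen_upper_sum_zero:
  assumes "eigen (Suc j) \<theta> f" and "\<forall>w\<in>Gr j. upper_sum (Suc j) f w = 0"
    and "y \<in> Gr (Suc j)" and "f y \<noteq> 0"
  shows "\<theta> = - real (q_num q (Suc j))"
proof -
  have "lower_sum j (upper_sum (Suc j) f) y = 0"
    using assms(2) by (simp add: lower_sum_def)
  then have "of_real (real (q_num q (Suc j)) + \<theta>) = (0 :: complex)"
    using eigen_lower_upper_sum[OF assms(1,3)] assms(4) by simp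
  then show ?thesis by (simp only: of_real_eq_0_iff)
qed

lemma eigen_0: "eigen 0 \<theta> f \<Longrightarrow> y \<in> Gr 0 \<Longrightarrow> f y \<noteq> 0 \<Longrightarrow> \<theta> = 0"
  by (auto simp: eigen_def nbr_sum_def)

lemma eigen_classification:
  assumes "1 \<le> j" and "2 * j < dimension" and "eigen j \<theta> f" and "\<exists>y\<in>Gr j. f y \<noteq> 0"
  shows "\<theta> = eigval0 j \<or> \<theta> < eigval1 j \<or>
    \<theta> = eigval1 j \<and> (\<exists>g. (\<Sum>p\<in>Gr (Suc 0). g p) = 0 \<and> (\<forall>y\<in>Gr j. f y = lower_sum (Suc 0) g y))"
  using assms
proof (induction j arbitrary: \<theta> f rule: dec_induct)
  case base
  have eig: "eigen (Suc 0) \<theta> f" using base by simp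
  obtain y where y: "y \<in> Gr (Suc 0)" "f y \<noteq> 0" using base by auto
  show ?case
  proof (cases "upper_sum (Suc 0) f {0} = 0")
    case True
    then have "\<theta> = eigval1 1"
      using eigen_upper_sum_zero[OF eig _ y] by (simp add: Gr_0 eigval1_def eigval0_def shift_def)
    moreover have "(\<Sum>p\<in>Gr (Suc 0). f p) = 0" using True by (simp add: upper_sum_zero_space)
    moreover have "\<forall>y\<in>Gr 1. f y = lower_sum (Suc 0) f y" by (simp add: lower_sum_same)
    ultimately show ?thesis by blast
  next
    case False
    have "\<theta> - shift 0 = 0"
      using eigen_0[OF eigen_upper_sum[OF eig] zero_mem_Gr False] .
    then show ?thesis by (simp add: eigval0_def)
  qed
next
  case (step j)
  note eig = \<open>eigen (Suc j) \<theta> f\<close>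
  let ?d = "upper_sum (Suc j) f"
  obtain y where y: "y \<in> Gr (Suc j)" "f y \<noteq> 0" using step.prems by auto
  note bound = eigval1_Suc_lower_bound[OF step.hyps(1) step.prems(1)]
  show ?case
  proof (cases "\<forall>w\<in>Gr j. ?d w = 0")
    case True
    then show ?thesis using eigen_upper_sum_zero[OF eig True y] bound by simp
  next
    case False
    have "2 * j < dimension" using step.prems by simp
    moreover have "\<exists>w\<in>Gr j. ?d w \<noteq> 0" using False by blast
    ultimately consider "\<theta> - shift j = eigval0 j" | "\<theta> - shift j < eigval1 j"
      | g where "\<theta> - shift j = eigval1 j" "(\<Sum>p\<in>Gr (Suc 0). g p) = 0"
          "\<forall>y\<in>Gr j. ?d y = lower_sum (Suc 0) g y"
      using step.IH[OF _ eigen_upper_sum[OF eig]] by blast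
    then show ?thesis
    proof cases
      case (3 g)
      have t: "\<theta> = eigval1 (Suc j)" using 3 by (simp add: eigval_Suc)
      define s where "s = complex_of_real (real (q_num q (Suc j)) + \<theta>)"
      have "s \<noteq> 0" unfolding s_def of_real_eq_0_iff using bound t by simp
      let ?g = "\<lambda>p. of_nat (q_num q j) / s * g p"
      have "f y = lower_sum (Suc 0) ?g y" if y: "y \<in> Gr (Suc j)" for y
      proof -
        have "s * f y = lower_sum j ?d y"
          using eigen_lower_upper_sum[OF eig y] by (simp add: s_def)
        also have "\<dots> = lower_sum j (lower_sum (Suc 0) g) y"
          using 3 by (intro lower_sum_cong) blast
        also have "\<dots> = of_nat (q_num q j) * lower_sum (Suc 0) g y"
          using lower_sum_lower_sum[OF y] step.hyps by simp
        finally show ?thesis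
          unfolding lower_sum_scale using \<open>s \<noteq> 0\<close> by (simp add: field_simps)
      qed
      moreover have "(\<Sum>p\<in>Gr (Suc 0). ?g p) = 0"
        unfolding sum_distrib_left[symmetric] using 3(2) by simp
      ultimately show ?thesis using t by blast
    qed (simp_all add: eigval_Suc)
  qed
qed

lemma finite_eigenvalues: "finite {\<theta>. \<exists>f. eigen j \<theta> f \<and> (\<exists>y\<in>Gr j. f y \<noteq> 0)}"
proof (induction j)
  case 0
  have "{\<theta>. \<exists>f. eigen 0 \<theta> f \<and> (\<exists>y\<in>Gr 0. f y \<noteq> 0)} \<subseteq> {0}"
    using eigen_0 by blast
  then show ?case by (rule finite_subset) simp
next
  case (Suc j)
  let ?E = "\<lambda>j. {\<theta>. \<exists>f. eigen j \<theta> f \<and> (\<exists>y\<in>Gr j. f y \<noteq> 0)}"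
  have "?E (Suc j) \<subseteq> insert (- real (q_num q (Suc j))) ((\<lambda>\<theta>. \<theta> + shift j) ` ?E j)"
  proof
    fix \<theta> assume "\<theta> \<in> ?E (Suc j)"
    then obtain f y where f: "eigen (Suc j) \<theta> f" and y: "y \<in> Gr (Suc j)" "f y \<noteq> 0" by blast
    show "\<theta> \<in> insert (- real (q_num q (Suc j))) ((\<lambda>\<theta>. \<theta> + shift j) ` ?E j)"
    proof (cases "\<forall>w\<in>Gr j. upper_sum (Suc j) f w = 0")
      case True
      then show ?thesis using eigen_upper_sum_zero[OF f True y] by simp
    next
      case False
      then have "\<theta> - shift j \<in> ?E j" using eigen_upper_sum[OF f] by blast
      then show ?thesis by (intro insertI2 image_eqI[of _ _ "\<theta> - shift j"]) auto
    qed
  qed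
  then show ?case using Suc by (rule finite_subset[OF _ finite.insertI[OF finite_imageI]])
qed

lemma card_containing_Suc:
  assumes w: "w \<in> Gr d" and w': "w' \<in> Gr (Suc d)" and "d \<le> k" and "k \<le> dimension"
  shows "card {z \<in> Gr k. w' \<subseteq> z} * q_num q (dimension - d) = card {z \<in> Gr k. w \<subseteq> z} * q_num q (k - d)"
proof (cases "k = d")
  case True
  have "\<not> w' \<subseteq> z" if "z \<in> Gr k" for z
    using w' True that dim_subset[of w' z] by (auto simp: mem_Gr)
  then have "{z \<in> Gr k. w' \<subseteq> z} = {}" by blast
  then show ?thesis using True by simp
next
  case False
  then have k: "Suc d \<le> k" using assms by auto
  let ?c = "card {z \<in> Gr k. w \<subseteq> z}" and ?c' = "card {z \<in> Gr k. w' \<subseteq> z}"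
  let ?F = "q_fact q (k - Suc d) * q_fact q (dimension - k)"
  have F: "q_fact q (k - d) = q_num q (k - d) * q_fact q (k - Suc d)"
    "q_fact q (dimension - d) = q_num q (dimension - d) * q_fact q (dimension - Suc d)"
    using k assms(4) q_fact_Suc[of q "k - Suc d"] q_fact_Suc[of q "dimension - Suc d"]
    by (simp_all add: Suc_diff_Suc)
  have "?c * q_num q (k - d) * ?F = q_num q (dimension - d) * q_fact q (dimension - Suc d)"
    using card_subspaces_containing[OF w assms(3,4)] unfolding F by (simp only: mult_ac)
  also have "\<dots> = ?c' * q_num q (dimension - d) * ?F"
    unfolding card_subspaces_containing[OF w' k assms(4), symmetric] by (simp only: mult_ac)
  finally show ?thesis using q_fact_pos[of q] by (simp add: less_imp_neq[THEN not_sym])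
qed

lemma ex_span_of_points:
  assumes p: "p \<in> Gr (Suc 0)" and p': "p' \<in> Gr (Suc 0)" and "p \<noteq> p'"
  obtains w where "w \<in> Gr (Suc (Suc 0))" and "\<And>u k. u \<in> Gr k \<Longrightarrow> p \<subseteq> u \<and> p' \<subseteq> u \<longleftrightarrow> w \<subseteq> u"
proof -
  have "card {u \<in> Gr (Suc (Suc 0)). p \<subseteq> u \<and> p' \<subseteq> u} = 1"
    using card_common_covers[OF assms] dim_Int_less[OF assms] by simp
  then have "{u \<in> Gr (Suc (Suc 0)). p \<subseteq> u \<and> p' \<subseteq> u} \<noteq> {}" by force
  then obtain w where w: "w \<in> Gr (Suc (Suc 0))" "p \<subseteq> w" "p' \<subseteq> w" by blast
  have "w \<subseteq> u" if u: "u \<in> Gr k" "p \<subseteq> u" "p' \<subseteq> u" for u k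
  proof -
    have sub: "subspace (w \<inter> u)" using w u by (simp add: mem_Gr subspace_inter)
    have "\<not> dim (w \<inter> u) \<le> 1"
    proof
      assume "dim (w \<inter> u) \<le> 1"
      then have "p = w \<inter> u" "p' = w \<inter> u"
        using p p' w u sub by (intro subspace_dim_equal; auto simp: mem_Gr)+
      with \<open>p \<noteq> p'\<close> show False by simp
    qed
    then have "w \<inter> u = w"
      using w sub by (intro subspace_dim_equal) (auto simp: mem_Gr)
    then show ?thesis by blast
  qed
  then show ?thesis using w by (intro that[of w]) blast+
qed

text \<open>The number of \<open>D\<close>-dimensional subspaces through one given point that avoid another one.\<close>

definition gram_eigval :: "nat \<Rightarrow> real" where
  "gram_eigval D = real (card (Gr D)) * real (q_num q D) * real (q_num q (dimension - D)) * real q ^ (D - 1)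
     / (real (q_num q dimension) * real (q_num q (dimension - 1)))"

lemma gram_points:
  assumes D: "1 \<le> D" "D < dimension" and p: "p \<in> Gr (Suc 0)" and p': "p' \<in> Gr (Suc 0)" and "p \<noteq> p'"
  shows "real (card {u \<in> Gr D. p \<subseteq> u \<and> p' \<subseteq> u}) = real (card {u \<in> Gr D. p \<subseteq> u}) - gram_eigval D"
proof -
  obtain w where w: "w \<in> Gr (Suc (Suc 0))"
    and wi: "\<And>u k. u \<in> Gr k \<Longrightarrow> p \<subseteq> u \<and> p' \<subseteq> u \<longleftrightarrow> w \<subseteq> u"
    using ex_span_of_points[OF p p' \<open>p \<noteq> p'\<close>] by blast
  let ?X = "real (card (Gr D))" and ?l = "real (card {u \<in> Gr D. p \<subseteq> u})"
    and ?l2 = "real (card {u \<in> Gr D. p \<subseteq> u \<and> p' \<subseteq> u})"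
  let ?b = "\<lambda>n. real (q_num q n)"
  have "{z \<in> Gr D. {0} \<subseteq> z} = Gr D" by (auto dest: zero_mem)
  then have "card {u \<in> Gr D. p \<subseteq> u} * q_num q dimension = card (Gr D) * q_num q D"
    using card_containing_Suc[OF zero_mem_Gr p, of D] D by simp
  then have 1: "?l * ?b dimension = ?X * ?b D"
    unfolding of_nat_mult[symmetric] of_nat_eq_iff .
  have "{u \<in> Gr D. p \<subseteq> u \<and> p' \<subseteq> u} = {u \<in> Gr D. w \<subseteq> u}" using wi by blast
  then have "card {u \<in> Gr D. p \<subseteq> u \<and> p' \<subseteq> u} * q_num q (dimension - 1)
      = card {u \<in> Gr D. p \<subseteq> u} * q_num q (D - 1)"
    using card_containing_Suc[OF p w, of D] D by simp
  then have 2: "?l2 * ?b (dimension - 1) = ?l * ?b (D - 1)"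
    unfolding of_nat_mult[symmetric] of_nat_eq_iff .
  have 3: "?b (dimension - 1) = ?b (D - 1) + real q ^ (D - 1) * ?b (dimension - D)"
  proof -
    have "dimension - 1 = (D - 1) + (dimension - D)" using D by simp
    then have "q_num q (dimension - 1) = q_num q (D - 1) + q ^ (D - 1) * q_num q (dimension - D)"
      by (simp only: q_num_add)
    then show ?thesis by simp
  qed
  have pos: "?b dimension > 0" "?b (dimension - 1) > 0"
    using D by (auto intro!: q_num_pos)
  have "(?l - ?l2) * ?b (dimension - 1) = ?l * (real q ^ (D - 1) * ?b (dimension - D))"
    using 2 unfolding 3 by (simp add: algebra_simps)
  then have "(?l - ?l2) * (?b dimension * ?b (dimension - 1))
      = (?l * ?b dimension) * (real q ^ (D - 1) * ?b (dimension - D))"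
    by (simp add: algebra_simps)
  then have "?l - ?l2 = (?X * ?b D) * (real q ^ (D - 1) * ?b (dimension - D)) / (?b dimension * ?b (dimension - 1))"
    unfolding 1 using pos by (intro eq_divide_imp) simp_all
  then have "?l - ?l2 = gram_eigval D"
    unfolding gram_eigval_def by (simp only: mult_ac)
  then show ?thesis by simp
qed

lemma upper_lower_sum_points:
  assumes D: "1 \<le> D" "D < dimension" and p: "p \<in> Gr (Suc 0)" and g: "(\<Sum>p\<in>Gr (Suc 0). g p) = 0"
  shows "upper_sum D (lower_sum (Suc 0) g) p = of_real (gram_eigval D) * g p"
proof -
  let ?l = "of_nat (card {u \<in> Gr D. p \<subseteq> u}) :: complex" and ?m = "complex_of_real (gram_eigval D)"
  have "upper_sum D (lower_sum (Suc 0) g) p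
      = (\<Sum>p'\<in>Gr (Suc 0). (?l - ?m) * g p' + (if p' = p then ?m * g p else 0))"
    unfolding upper_lower_sum
  proof (intro sum.cong refl)
    fix p' assume p': "p' \<in> Gr (Suc 0)"
    show "of_nat (card {u \<in> Gr D. p \<subseteq> u \<and> p' \<subseteq> u}) * g p'
        = (?l - ?m) * g p' + (if p' = p then ?m * g p else 0)"
    proof (cases "p = p'")
      case False
      have "(of_nat (card {u \<in> Gr D. p \<subseteq> u \<and> p' \<subseteq> u}) :: complex) = ?l - ?m"
        using arg_cong[OF gram_points[OF D p p' False], of complex_of_real] by simp
      then show ?thesis using False by simp
    qed (simp add: algebra_simps)
  qed
  also have "\<dots> = (?l - ?m) * (\<Sum>p'\<in>Gr (Suc 0). g p') + ?m * g p"
    using p by (simp add: sum.distrib sum_distrib_left)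
  finally show ?thesis using g by simp
qed

lemma gram_eigval_pos:
  assumes "1 \<le> D" and "D < dimension" and "Gr D \<noteq> {}"
  shows "gram_eigval D > 0"
  unfolding gram_eigval_def using assms q_gt_1
  by (intro divide_pos_pos mult_pos_pos) (auto intro!: q_num_pos simp: card_gt_0_iff)

end

section \<open>The dual adjacency matrix\<close>

lemma nth_eigenvalue_1_eqI:
  assumes "finite (real_eigenvalues X M)" and "k \<in> real_eigenvalues X M" and "t \<in> real_eigenvalues X M"
    and "t < k" and dom: "\<And>s. s \<in> real_eigenvalues X M \<Longrightarrow> s = k \<or> s \<le> t"
  shows "nth_eigenvalue X M 1 = t"
proof -
  let ?S = "real_eigenvalues X M"
  let ?xs = "sorted_list_of_set (?S - {k, t}) @ [t, k]"
  have set: "set ?xs = ?S" using assms(1-3) by auto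
  have "s < t" if "s \<in> ?S - {k, t}" for s
    using that dom[of s] by auto
  then have "sorted ?xs" and "distinct ?xs"
    using assms(1,4) by (auto simp: sorted_append dest: less_trans[OF _ assms(4)] intro: less_imp_le)
  then have "sorted_list_of_set (set ?xs) = ?xs"
    by (intro sorted_list_of_set.idem_if_sorted_distinct) auto
  then show ?thesis unfolding nth_eigenvalue_def set by simp
qed

lemma orth_proj_eqI:
  assumes X: "finite X" and U: "U \<subseteq> coord_space X"
    and diff: "\<And>u v. u \<in> U \<Longrightarrow> v \<in> U \<Longrightarrow> (\<lambda>y. u y - v y) \<in> U"
    and g: "g \<in> U" and orth: "\<And>u. u \<in> U \<Longrightarrow> hermitian X (\<lambda>y. f y - g y) u = 0"
  shows "orth_proj X U f = g"
  unfolding orth_proj_def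
proof (rule the_equality)
  fix h assume h: "h \<in> U \<and> (\<forall>u\<in>U. hermitian X (\<lambda>y. f y - h y) u = 0)"
  let ?d = "\<lambda>y. h y - g y"
  have d: "?d \<in> U" using h g diff by blast
  have "hermitian X ?d ?d = hermitian X (\<lambda>y. f y - g y) ?d - hermitian X (\<lambda>y. f y - h y) ?d"
    unfolding hermitian_def sum_subtractf[symmetric] by (intro sum.cong) (auto simp: algebra_simps)
  also have "\<dots> = 0" using h orth d by simp
  finally have "complex_of_real (\<Sum>y\<in>X. (cmod (?d y))\<^sup>2) = 0"
    unfolding hermitian_def of_real_sum complex_norm_square .
  then have "(\<Sum>y\<in>X. (cmod (?d y))\<^sup>2) = 0"
    by (simp only: of_real_eq_0_iff)
  then have "\<forall>y\<in>X. ?d y = 0"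
    using X by (simp add: sum_nonneg_eq_0_iff)
  moreover have "\<forall>y. y \<notin> X \<longrightarrow> ?d y = 0" using d U by (auto simp: coord_space_def)
  ultimately show "h = g" by (intro ext) (metis eq_iff_diff_eq_0)
qed (use g orth in blast)

lemma q_bracket_of_nat: "1 < q \<Longrightarrow> q_bracket q (int n) = real (q_num q n)"
  by (simp add: q_bracket_def of_nat_q_num)

lemma dual_eigenvalue_identity:
  fixes Q a b e :: real
  assumes "Q > 1" and "a > 1" and "b > 1"
  shows "(a * b - 1) * (a * b - Q) / ((a - 1) * (b - 1) * a)
      * ((e - 1) / (Q - 1) - ((a - 1) / (Q - 1))\<^sup>2 / ((a * b - 1) / (Q - 1)))
    = - (Q * ((a * b / Q - 1) / (Q - 1)) * ((a - 1) / (Q - 1) + (b - 1) / (Q - 1)))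
         / ((Q - 1) * ((a - 1) / (Q - 1)) * ((b - 1) / (Q - 1)))
      + (Q * ((a * b - 1) / (Q - 1)) * ((a * b / Q - 1) / (Q - 1)))
         / ((Q - 1) * ((a - 1) / (Q - 1)) * ((b - 1) / (Q - 1))) * (e / a)"
proof -
  define c A B P R where "c = Q - 1" and "A = a - 1" and "B = b - 1" and "P = a * b - 1" and "R = a * b - Q"
  have "P \<noteq> 0" using less_1_mult[of a b] assms by (simp add: P_def)
  then have nz: "c \<noteq> 0" "A \<noteq> 0" "B \<noteq> 0" "P \<noteq> 0" "a \<noteq> 0" "Q \<noteq> 0"
    using assms by (simp_all add: c_def A_def B_def)
  have R: "a * b / Q - 1 = R / Q" using nz by (simp add: R_def field_simps)
  have poly: "P * (e - 1) - A\<^sup>2 = P * e - a * (A + B)"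
    by (simp add: P_def A_def B_def power2_eq_square algebra_simps)
  have "P * R / (A * B * a) * ((e - 1) / c - (A / c)\<^sup>2 / (P / c))
      = R / (A * B * a * c) * (P * (e - 1) - A\<^sup>2)"
    using nz by (simp add: power2_eq_square field_simps)
  also have "\<dots> = - (R * (A + B) / (A * B * c)) + R * P / (A * B * c) * (e / a)"
    unfolding poly using nz by (simp add: field_simps)
  also have "R * (A + B) / (A * B * c) = Q * (R / Q / c) * (A / c + B / c) / (c * (A / c) * (B / c))"
    using nz by (simp add: field_simps)
  also have "R * P / (A * B * c) = Q * (P / c) * (R / Q / c) / (c * (A / c) * (B / c))"
    using nz by (simp add: field_simps)
  finally show ?thesis
    unfolding R c_def[symmetric] A_def[symmetric] B_def[symmetric] P_def[symmetric] R_def[symmetric]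
    by (simp only: minus_divide_left)
qed

context finite_field_vector_space
begin

lemma mat_vec_adjacency:
  assumes "1 \<le> D" and "y \<in> Gr D"
  shows "mat_vec (Gr D) (grassmann_adjacency scale D) f y = nbr_sum D f y"
proof -
  have "mat_vec (Gr D) (grassmann_adjacency scale D) f y
      = (\<Sum>z\<in>Gr D. if Suc (dim (y \<inter> z)) = D then f z else 0)"
    using assms unfolding mat_vec_def grassmann_adjacency_def
    by (auto intro!: sum.cong)
  also have "\<dots> = nbr_sum D f y"
    unfolding nbr_sum_def by (rule sum.inter_filter[symmetric]) simp
  finally show ?thesis .
qed

lemma eigenspace_adjacency:
  assumes "1 \<le> D"
  shows "eigenspace (Gr D) (grassmann_adjacency scale D) (of_real \<theta>)
    = {f \<in> coord_space (Gr D). eigen D \<theta> f}"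
proof -
  have "mat_vec (Gr D) (grassmann_adjacency scale D) f = (\<lambda>y. of_real \<theta> * f y) \<longleftrightarrow> eigen D \<theta> f"
    if "f \<in> coord_space (Gr D)" for f
  proof -
    have "mat_vec (Gr D) (grassmann_adjacency scale D) f y = of_real \<theta> * f y" if "y \<notin> Gr D" for y
      using that \<open>f \<in> coord_space (Gr D)\<close> by (simp add: mat_vec_def coord_space_def)
    then show ?thesis
      unfolding fun_eq_iff eigen_def using mat_vec_adjacency[OF assms] by metis
  qed
  then show ?thesis unfolding eigenspace_def by blast
qed

lemma real_eigenvalues_adjacency:
  assumes "1 \<le> D"
  shows "real_eigenvalues (Gr D) (grassmann_adjacency scale D)
    = {\<theta>. \<exists>f. eigen D \<theta> f \<and> (\<exists>y\<in>Gr D. f y \<noteq> 0)}"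
proof (intro equalityI subsetI)
  fix \<theta> assume "\<theta> \<in> real_eigenvalues (Gr D) (grassmann_adjacency scale D)"
  then obtain f where f: "f \<in> coord_space (Gr D)" "eigen D \<theta> f" "f \<noteq> (\<lambda>_. 0)"
    unfolding real_eigenvalues_def eigenspace_adjacency[OF assms] by blast
  then obtain y where "f y \<noteq> 0" by blast
  then have "y \<in> Gr D" using f(1) unfolding coord_space_def by blast
  with \<open>f y \<noteq> 0\<close> f(2) show "\<theta> \<in> {\<theta>. \<exists>f. eigen D \<theta> f \<and> (\<exists>y\<in>Gr D. f y \<noteq> 0)}" by blast
next
  fix \<theta> assume "\<theta> \<in> {\<theta>. \<exists>f. eigen D \<theta> f \<and> (\<exists>y\<in>Gr D. f y \<noteq> 0)}"
  then obtain f y where f: "eigen D \<theta> f" and y: "y \<in> Gr D" "f y \<noteq> 0" by blast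
  let ?f = "\<lambda>y. if y \<in> Gr D then f y else 0"
  have "eigen D \<theta> ?f" using f eigen_cong[of D f ?f] by simp
  moreover have "?f \<in> coord_space (Gr D)" by (simp add: coord_space_def)
  moreover have "?f \<noteq> (\<lambda>_. 0)" using y by (metis (full_types))
  ultimately show "\<theta> \<in> real_eigenvalues (Gr D) (grassmann_adjacency scale D)"
    unfolding real_eigenvalues_def eigenspace_adjacency[OF assms] by blast
qed

lemma nth_eigenvalue_1:
  assumes "1 \<le> D" and "2 * D < dimension" and ne: "Gr D \<noteq> {}"
  shows "nth_eigenvalue (Gr D) (grassmann_adjacency scale D) 1 = eigval1 D"
proof (rule nth_eigenvalue_1_eqI[where k = "eigval0 D"], unfold real_eigenvalues_adjacency[OF assms(1)])
  let ?E = "{\<theta>. \<exists>f. eigen D \<theta> f \<and> (\<exists>y\<in>Gr D. f y \<noteq> 0)}"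
  show "finite ?E" by (rule finite_eigenvalues)
  show "s = eigval0 D \<or> s \<le> eigval1 D" if "s \<in> ?E" for s
    using that eigen_classification[OF assms(1,2), of s] by (auto intro: less_imp_le)
  show "eigval1 D < eigval0 D"
    using q_num_pos[of dimension q] assms by (simp add: eigval1_def)
  obtain y where y: "y \<in> Gr D" using ne by blast
  have "{z. z \<in> Gr 0 \<and> z \<subseteq> y} = {{0}}" using zero_mem[OF y] by (auto simp: Gr_0)
  then have "lower_sum 0 (\<lambda>_. 1) y \<noteq> 0" by (simp add: lower_sum_def)
  then show "eigval0 D \<in> ?E" using eigen_const y by blast
  have "card (Gr (Suc 0)) = q_num q dimension"
    using card_points_in[OF UNIV_mem_Gr] by simp
  also have "\<dots> > 1"
    using q_num_strict_mono[of q 1 dimension] q_gt_1 assms by simp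
  finally obtain p p' where p: "p \<in> Gr (Suc 0)" "p' \<in> Gr (Suc 0)" "p \<noteq> p'"
    using card_le_Suc0_iff_eq[of "Gr (Suc 0)"] by (metis finite_sets leD One_nat_def)
  define g where "g = (\<lambda>z. if z = p then 1 else if z = p' then - 1 else (0 :: complex))"
  have "(\<Sum>z\<in>Gr (Suc 0). g z) = (\<Sum>z\<in>{p, p'}. g z)"
    using p by (intro sum.mono_neutral_right) (auto simp: g_def)
  then have g: "(\<Sum>z\<in>Gr (Suc 0). g z) = 0" using p by (simp add: g_def)
  have D: "D < dimension" using assms by simp
  have "upper_sum D (lower_sum (Suc 0) g) p \<noteq> 0"
    unfolding upper_lower_sum_points[OF assms(1) D p(1) g]
    using gram_eigval_pos[OF assms(1) D ne] by (simp add: g_def)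
  then have "\<exists>y\<in>Gr D. lower_sum (Suc 0) g y \<noteq> 0"
    unfolding upper_sum_def by (metis (mono_tags, lifting) mem_Collect_eq sum.neutral)
  then show "eigval1 D \<in> ?E" using eigen_points[OF assms(1) g] by blast
qed

lemma hermitian_lower_sum:
  "hermitian (Gr D) (lower_sum i h) f = (\<Sum>p\<in>Gr i. h p * cnj (upper_sum D f p))"
proof -
  have "hermitian (Gr D) (lower_sum i h) f = (\<Sum>y\<in>Gr D. \<Sum>p | p \<in> Gr i \<and> p \<subseteq> y. h p * cnj (f y))"
    by (simp add: hermitian_def lower_sum_def sum_distrib_right)
  also have "\<dots> = (\<Sum>p\<in>Gr i. \<Sum>y | y \<in> Gr D \<and> p \<subseteq> y. h p * cnj (f y))"
    by (rule sum.swap_restrict) simp_all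
  finally show ?thesis by (simp add: upper_sum_def sum_distrib_left)
qed

definition point_weight :: "nat \<Rightarrow> 'v set \<Rightarrow> 'v set \<Rightarrow> complex" where
  "point_weight D z p = of_real (((if p \<subseteq> z then 1 else 0) - real (q_num q D) / real (q_num q dimension))
     / gram_eigval D)"

lemma sum_point_indicator: "(\<Sum>p\<in>Gr (Suc 0). if p \<subseteq> z then f p else 0) = lower_sum (Suc 0) f z"
  unfolding lower_sum_def by (rule sum.inter_filter[symmetric]) simp

lemma grassmann_E1_eq:
  assumes D: "1 \<le> D" "2 * D < dimension" and x: "x \<in> Gr D" and z: "z \<in> Gr D"
  shows "grassmann_E1 scale D x z = lower_sum (Suc 0) (point_weight D z) x"
proof -
  let ?X = "Gr D" and ?A = "grassmann_adjacency scale D" and ?h = "point_weight D z"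
  let ?g = "\<lambda>y. if y \<in> ?X then lower_sum (Suc 0) ?h y else 0"
  let ?U = "{f \<in> coord_space ?X. eigen D (eigval1 D) f}"
  let ?m = "complex_of_real (gram_eigval D)"
  let ?c = "complex_of_real (real (q_num q D) / real (q_num q dimension))"
  have D': "D < dimension" using D by simp
  have ne: "?X \<noteq> {}" using x by blast
  have m: "?m \<noteq> 0" using gram_eigval_pos[OF D(1) D' ne] by simp
  have h: "?h p = ((if p \<subseteq> z then 1 else 0) - ?c) / ?m" for p
    by (simp add: point_weight_def)
  have bN: "real (q_num q dimension) \<noteq> 0"
    using q_num_pos[of dimension q] D by simp
  have "(\<Sum>p\<in>Gr (Suc 0). (if p \<subseteq> z then 1 else 0) - ?c) = of_nat (q_num q D) - of_nat (q_num q dimension) * ?c"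
    using card_points_in[OF z] card_points_in[OF UNIV_mem_Gr]
    by (simp add: sum_subtractf sum_point_indicator lower_sum_def)
  also have "\<dots> = 0" using bN by simp
  finally have sum_h: "(\<Sum>p\<in>Gr (Suc 0). ?h p) = 0"
    unfolding h sum_divide_distrib[symmetric] by simp
  have "orth_proj ?X ?U (unit_vector z) = ?g"
  proof (rule orth_proj_eqI)
    show "(\<lambda>y. u y - v y) \<in> ?U" if "u \<in> ?U" "v \<in> ?U" for u v
      using that by (auto simp: coord_space_def eigen_def nbr_sum_def sum_subtractf algebra_simps)
    show "?g \<in> ?U"
      using eigen_points[OF D(1) sum_h] eigen_cong[of D ?g "lower_sum (Suc 0) ?h"]
      by (simp add: coord_space_def)
    show "hermitian ?X (\<lambda>y. unit_vector z y - ?g y) u = 0" if "u \<in> ?U" for u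
    proof (cases "\<exists>y\<in>?X. u y \<noteq> 0")
      case True
      have eig: "eigen D (eigval1 D) u" using that by simp
      have "eigval1 D < eigval0 D"
        using bN by (simp add: eigval1_def)
      then obtain g where g: "(\<Sum>p\<in>Gr (Suc 0). g p) = 0" and ug: "\<forall>y\<in>?X. u y = lower_sum (Suc 0) g y"
        using eigen_classification[OF D eig True] by auto
      have "hermitian ?X ?g u = hermitian ?X (lower_sum (Suc 0) ?h) (lower_sum (Suc 0) g)"
        using ug by (simp add: hermitian_def)
      also have "\<dots> = (\<Sum>p\<in>Gr (Suc 0). ?h p * cnj (?m * g p))"
        unfolding hermitian_lower_sum
        by (intro sum.cong refl) (simp add: upper_lower_sum_points[OF D(1) D' _ g])
      also have "\<dots> = (\<Sum>p\<in>Gr (Suc 0). cnj (if p \<subseteq> z then g p else 0) - ?c * cnj (g p))"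
        using m by (intro sum.cong refl) (auto simp: h field_simps)
      also have "\<dots> = cnj (u z) - ?c * cnj (\<Sum>p\<in>Gr (Suc 0). g p)"
        using ug z unfolding sum_subtractf sum_distrib_left[symmetric] cnj_sum[symmetric] sum_point_indicator
        by simp
      finally have 1: "hermitian ?X ?g u = cnj (u z)" using g by simp
      have "hermitian ?X (unit_vector z) u = (\<Sum>y\<in>?X. if y = z then cnj (u y) else 0)"
        unfolding hermitian_def unit_vector_def by (intro sum.cong refl) auto
      then have "hermitian ?X (unit_vector z) u = cnj (u z)" using z by simp
      with 1 show ?thesis
        by (simp add: hermitian_def left_diff_distrib sum_subtractf)
    qed (simp add: hermitian_def)
  qed auto
  then show ?thesis
    unfolding grassmann_E1_def orth_proj_matrix_def Let_def nth_eigenvalue_1[OF D ne]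
      eigenspace_adjacency[OF D(1)] using x by simp
qed

lemma lower_sum_point_weight:
  assumes "x \<in> Gr D" and "z \<in> Gr D"
  shows "lower_sum (Suc 0) (point_weight D z) x
    = of_real ((real (q_num q (dim (z \<inter> x))) - (real (q_num q D))\<^sup>2 / real (q_num q dimension)) / gram_eigval D)"
proof -
  have "z \<inter> x \<in> Gr (dim (z \<inter> x))" using assms by (simp add: mem_Gr subspace_inter)
  note 1 = card_points_in[OF this] card_points_in[OF assms(1)]
  let ?L = "{p. p \<in> Gr (Suc 0) \<and> p \<subseteq> x}"
  have "(\<Sum>p\<in>?L. if p \<subseteq> z then 1 else (0::real)) = real (card {p \<in> ?L. p \<subseteq> z})"
    by (simp add: sum.inter_filter[symmetric])
  also have "{p \<in> ?L. p \<subseteq> z} = {p \<in> Gr (Suc 0). p \<subseteq> z \<inter> x}" by auto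
  finally have 2: "(\<Sum>p\<in>?L. if p \<subseteq> z then 1 else (0::real)) = real (q_num q (dim (z \<inter> x)))"
    using 1 by simp
  show ?thesis
    unfolding lower_sum_def point_weight_def of_real_sum[symmetric] sum_divide_distrib[symmetric]
      sum_subtractf 2
    using 1 by (simp add: power2_eq_square)
qed

lemma dual_eigenvalue_eq:
  assumes D: "1 \<le> D" "D < dimension" and ne: "Gr D \<noteq> {}" and "d \<le> D"
  shows "real (card (Gr D)) * ((real (q_num q d) - (real (q_num q D))\<^sup>2 / real (q_num q dimension)) / gram_eigval D)
    = dual_eigenvalue q dimension D (D - d)"
proof -
  define Q a b e where "Q = real q" and "a = Q ^ D" and "b = Q ^ (dimension - D)" and "e = Q ^ d"
  have "Q > 1" using q_gt_1 by (simp add: Q_def)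
  then have ab: "a > 1" "b > 1" using D by (simp_all add: a_def b_def)
  have N: "Q ^ dimension = a * b" using D by (simp add: a_def b_def flip: power_add)
  have "Q ^ (dimension - 1) * Q = a * b"
    using D N by (simp flip: power_Suc2)
  then have N1: "Q ^ (dimension - 1) = a * b / Q" using \<open>Q > 1\<close> by (simp add: field_simps)
  have "Q ^ (D - 1) * Q = a" using D by (simp add: a_def flip: power_Suc2)
  then have D1: "Q ^ (D - 1) = a / Q" using \<open>Q > 1\<close> by (simp add: field_simps)
  have "Q ^ (D - d) * e = a" using \<open>d \<le> D\<close> by (simp add: a_def e_def flip: power_add)
  then have "inverse (Q ^ (D - d)) = e / a" using ab \<open>Q > 1\<close> by (auto simp: e_def field_simps)
  then have Dd: "Q powi (- int (D - d)) = e / a" by (simp add: power_int_minus)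
  have X: "real (card (Gr D)) \<noteq> 0" using ne by simp
  have int: "int dimension - 1 = int (dimension - 1)" "int dimension - int D = int (dimension - D)"
    using D by simp_all
  have "real (card (Gr D)) / gram_eigval D = real (q_num q dimension) * real (q_num q (dimension - 1))
      / (real (q_num q D) * real (q_num q (dimension - D)) * Q ^ (D - 1))"
    using X by (simp add: gram_eigval_def Q_def)
  also have "\<dots> = ((a * b - 1) / (Q - 1)) * ((a * b / Q - 1) / (Q - 1)) / (((a - 1) / (Q - 1)) * ((b - 1) / (Q - 1)) * (a / Q))"
    using q_gt_1 N N1 D1 by (simp add: of_nat_q_num flip: Q_def a_def b_def)
  also have "a * b / Q - 1 = (a * b - Q) / Q" using \<open>Q > 1\<close> by (simp add: field_simps)
  also have "(A / c) * (B / Q / c) / ((A' / c) * (B' / c) * (a / Q)) = A * B / (A' * B' * a)"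
    if "c \<noteq> 0" for A B A' B' c :: real
    using that \<open>Q > 1\<close> by (simp add: divide_simps)
  finally have 1: "real (card (Gr D)) / gram_eigval D = (a * b - 1) * (a * b - Q) / ((a - 1) * (b - 1) * a)"
    using \<open>Q > 1\<close> by simp
  have "real (card (Gr D)) * ((real (q_num q d) - (real (q_num q D))\<^sup>2 / real (q_num q dimension)) / gram_eigval D)
      = (real (card (Gr D)) / gram_eigval D) * ((e - 1) / (Q - 1) - ((a - 1) / (Q - 1))\<^sup>2 / ((a * b - 1) / (Q - 1)))"
    using q_gt_1 N by (simp add: of_nat_q_num flip: Q_def a_def e_def)
  also have "\<dots> = dual_eigenvalue q dimension D (D - d)"
    unfolding 1 dual_eigenvalue_identity[OF \<open>Q > 1\<close> ab] dual_eigenvalue_def int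
      q_bracket_of_nat[OF q_gt_1] of_nat_q_num[OF q_gt_1]
      Q_def[symmetric] N N1 Dd a_def[symmetric] b_def[symmetric]
    by (simp only: mult_minus_left)
  finally show ?thesis .
qed

lemma dual_adjacency_N_vector:
  assumes D: "1 \<le> D" "2 * D < dimension" and x: "x \<in> Gr D" and "\<alpha> \<subseteq> x"
  shows "mat_vec (Gr D) (dual_adjacency scale D x) (N_vector scale D x \<alpha>)
    = (\<lambda>y. of_real (dual_eigenvalue q dimension D (D - dim \<alpha>)) * N_vector scale D x \<alpha> y)"
proof
  fix y
  let ?v = "N_vector scale D x \<alpha>"
  have v: "?v y = (if y \<in> Gr D \<and> y \<inter> x = \<alpha> then 1 else 0)" for y
    by (simp add: N_vector_def unit_vector_def)
  have D': "D < dimension" and ne: "Gr D \<noteq> {}" using D x by auto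
  have d: "dim \<alpha> \<le> D" using dim_subset[OF \<open>\<alpha> \<subseteq> x\<close>] x by (simp add: mem_Gr)
  show "mat_vec (Gr D) (dual_adjacency scale D x) ?v y
      = of_real (dual_eigenvalue q dimension D (D - dim \<alpha>)) * ?v y"
  proof (cases "y \<in> Gr D \<and> y \<inter> x = \<alpha>")
    case False
    then have "?v y = 0" by (simp add: v)
    then have "dual_adjacency scale D x y z * ?v z = 0" for z
      by (cases "z = y") (auto simp: dual_adjacency_def)
    then have "mat_vec (Gr D) (dual_adjacency scale D x) ?v y = 0"
      unfolding mat_vec_def by (simp only: sum.neutral_const if_cancel)
    then show ?thesis unfolding \<open>?v y = 0\<close> by simp
  next
    case True
    then have y: "y \<in> Gr D" and \<alpha>: "y \<inter> x = \<alpha>" by simp_all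
    have "mat_vec (Gr D) (dual_adjacency scale D x) ?v y
        = (\<Sum>z\<in>Gr D. dual_adjacency scale D x y z * ?v z)"
      using y by (simp add: mat_vec_def)
    also have "\<dots> = (\<Sum>z\<in>Gr D. if z = y then dual_adjacency scale D x y y * ?v y else 0)"
      by (intro sum.cong refl) (simp add: dual_adjacency_def)
    also have "\<dots> = of_nat (card (Gr D)) * grassmann_E1 scale D x y"
      using y \<alpha> by (simp add: v dual_adjacency_def)
    also have "\<dots> = of_real (real (card (Gr D)) *
        ((real (q_num q (dim \<alpha>)) - (real (q_num q D))\<^sup>2 / real (q_num q dimension)) / gram_eigval D))"
      unfolding grassmann_E1_eq[OF D x y] lower_sum_point_weight[OF x y] \<alpha> by simp
    also have "\<dots> = of_real (dual_eigenvalue q dimension D (D - dim \<alpha>))"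
      by (simp only: dual_eigenvalue_eq[OF D(1) D' ne d])
    finally show ?thesis using y \<alpha> by (simp add: v)
  qed
qed

end

theorem theorem8p3:
  fixes scale :: "'k::{field,finite} \<Rightarrow> 'v::ab_group_add \<Rightarrow> 'v"
    and N D q :: nat
    and x \<alpha> :: "'v set"
  assumes "vector_space scale"
    and "CARD('k) = q"
    and "vector_space.dim scale (UNIV :: 'v set) = N"
    and "D \<ge> 1"
    and "N > 2 * D"
    and "x \<in> grassmann_vertices scale D"
    and "module.subspace scale \<alpha>"
    and "\<alpha> \<subseteq> x"
  shows "mat_vec (grassmann_vertices scale D) (dual_adjacency scale D x) (N_vector scale D x \<alpha>)
         = (\<lambda>y. complex_of_real (dual_eigenvalue q N D (D - vector_space.dim scale \<alpha>))
                * N_vector scale D x \<alpha> y)"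
proof -
  interpret vs: vector_space scale by fact
  obtain B where B: "B \<subseteq> UNIV" "vs.independent B" "UNIV \<subseteq> vs.span B" "card B = vs.dim (UNIV :: 'v set)"
    by (rule vs.basis_exists)
  have "finite B" using B(4) assms(3,5) by (intro card_ge_0_finite) simp
  interpret finite_field_vector_space scale B q
    by unfold_locales (use B(2,3) \<open>finite B\<close> assms(2) in \<open>simp_all add: top.extremum_unique\<close>)
  have "dimension = N" using B(4) assms(3) by (simp add: dimension_def)
  then show ?thesis
    using dual_adjacency_N_vector[OF assms(4) _ assms(6,8)] assms(5) by simp
qed

end
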